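(* Let $A$ be an ISP-ring and $S\subseteq A$ a multiplicatively closed set which consists only of regular elements. Then the fraction ring $A_S$ is an ISP-ring. In particular, for every prime ideal $P$ of $A$, the regular localization $A_{(P)}$ is an ISP-ring.
   Context: All rings are commutative with a nonzero unit. An element of a ring is regular if it is not a zero-divisor; an ideal is regular if it contains at least one regular element. A proper ideal $H$ is a radical ideal if $\sqrt H=H$. An ideal $J$ of $A$ is invertible if $JJ'=A$ for some $A$-submodule $J'$ of the total quotient ring $T(A)$; equivalently, $J$ is finitely generated, regular, and $J_M$ is a principal ideal of $A_M$ for each maximal ideal $M$ of $A$ (the ideal $A$ itself is allowed). A ring $A$ is an ISP-ring if every proper regular ideal of $A$ can be written as $JH_1\cdots H_n$ with $J$ an invertible ideal, $n\ge 1$, and all $H_i$ proper radical ideals. For a prime ideal $P$ of $A$, the regular localization is $A_{(P)}=\{a/b\in T(A) : a\in A,\ b\in A\setminus P,\ b \text{ regular}\}$. *)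

theory Defs
  imports "HOL-Algebra.Ideal_Product" "HOL-Algebra.Module"
begin

definition regular_elements :: "('a, 'm) ring_scheme \<Rightarrow> 'a set" where
  "regular_elements R =
     {a \<in> carrier R. \<forall>b\<in>carrier R. a \<otimes>\<^bsub>R\<^esub> b = \<zero>\<^bsub>R\<^esub> \<longrightarrow> b = \<zero>\<^bsub>R\<^esub>}"

definition regular_ideal :: "('a, 'm) ring_scheme \<Rightarrow> 'a set \<Rightarrow> bool" where
  "regular_ideal R I \<longleftrightarrow> ideal I R \<and> I \<inter> regular_elements R \<noteq> {}"

definition ideal_radical :: "('a, 'm) ring_scheme \<Rightarrow> 'a set \<Rightarrow> 'a set" where
  "ideal_radical R H = {x \<in> carrier R. \<exists>n::nat. n > 0 \<and> x [^]\<^bsub>R\<^esub> n \<in> H}"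

definition proper_radical_ideal :: "('a, 'm) ring_scheme \<Rightarrow> 'a set \<Rightarrow> bool" where
  "proper_radical_ideal R H \<longleftrightarrow> ideal H R \<and> H \<noteq> carrier R \<and> ideal_radical R H = H"

definition frac_rel :: "('a, 'm) ring_scheme \<Rightarrow> 'a set \<Rightarrow> (('a \<times> 'a) \<times> ('a \<times> 'a)) set" where
  "frac_rel R S =
     {((a, s), (b, t)). a \<in> carrier R \<and> b \<in> carrier R \<and> s \<in> S \<and> t \<in> S \<and>
        (\<exists>u\<in>S. u \<otimes>\<^bsub>R\<^esub> (t \<otimes>\<^bsub>R\<^esub> a \<ominus>\<^bsub>R\<^esub> s \<otimes>\<^bsub>R\<^esub> b) = \<zero>\<^bsub>R\<^esub>)}"

text \<open>\<open>fraction R S a s\<close> is the element \<open>a / s\<close> of \<open>R\<^sub>S\<close>.\<close>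

definition fraction :: "('a, 'm) ring_scheme \<Rightarrow> 'a set \<Rightarrow> 'a \<Rightarrow> 'a \<Rightarrow> ('a \<times> 'a) set" where
  "fraction R S a s = frac_rel R S `` {(a, s)}"

text \<open>The ring of fractions \<open>R\<^sub>S\<close> together with its \<open>R\<close>-module structure, for a submonoid \<open>S\<close> of
  \<open>(R, \<otimes>)\<close>. The unions in the operations range over all representatives; as all of them yield the
  same class, the union is that class.\<close>

definition fraction_ring :: "('a, 'm) ring_scheme \<Rightarrow> 'a set \<Rightarrow> ('a, ('a \<times> 'a) set) module" where
  "fraction_ring R S =
     \<lparr>carrier = (carrier R \<times> S) // frac_rel R S,
      mult = (\<lambda>x y. \<Union>(a, s)\<in>x. \<Union>(b, t)\<in>y. fraction R S (a \<otimes>\<^bsub>R\<^esub> b) (s \<otimes>\<^bsub>R\<^esub> t)),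
      one = fraction R S \<one>\<^bsub>R\<^esub> \<one>\<^bsub>R\<^esub>,
      zero = fraction R S \<zero>\<^bsub>R\<^esub> \<one>\<^bsub>R\<^esub>,
      add = (\<lambda>x y. \<Union>(a, s)\<in>x. \<Union>(b, t)\<in>y.
               fraction R S (t \<otimes>\<^bsub>R\<^esub> a \<oplus>\<^bsub>R\<^esub> s \<otimes>\<^bsub>R\<^esub> b) (s \<otimes>\<^bsub>R\<^esub> t)),
      smult = (\<lambda>r x. \<Union>(a, s)\<in>x. fraction R S (r \<otimes>\<^bsub>R\<^esub> a) s)\<rparr>"

definition total_quotient_ring :: "('a, 'm) ring_scheme \<Rightarrow> ('a, ('a \<times> 'a) set) module" where
  "total_quotient_ring R = fraction_ring R (regular_elements R)"

definition to_total_quotient :: "('a, 'm) ring_scheme \<Rightarrow> 'a \<Rightarrow> ('a \<times> 'a) set" where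
  "to_total_quotient R a = fraction R (regular_elements R) a \<one>\<^bsub>R\<^esub>"

text \<open>\<open>ideal_prod\<close> over the total quotient ring is the set of finite sums of products, that is,
  the product of two \<open>R\<close>-submodules; \<open>J\<close> and \<open>R\<close> are identified with their images there.\<close>

definition invertible_ideal :: "('a, 'm) ring_scheme \<Rightarrow> 'a set \<Rightarrow> bool" where
  "invertible_ideal R J \<longleftrightarrow> ideal J R \<and>
     (\<exists>J'. submodule J' R (total_quotient_ring R) \<and>
        ideal_prod (total_quotient_ring R) (to_total_quotient R ` J) J'
          = to_total_quotient R ` carrier R)"

text \<open>The list \<open>Hs\<close> is \<open>[H\<^sub>1, \<dots>, H\<^sub>n]\<close>, and the \<open>foldl\<close> is the product \<open>J H\<^sub>1 \<dots> H\<^sub>n\<close>.\<close>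

definition ISP_ring :: "('a, 'm) ring_scheme \<Rightarrow> bool" where
  "ISP_ring R \<longleftrightarrow> cring R \<and> \<one>\<^bsub>R\<^esub> \<noteq> \<zero>\<^bsub>R\<^esub> \<and>
     (\<forall>I. regular_ideal R I \<and> I \<noteq> carrier R \<longrightarrow>
        (\<exists>J Hs. invertible_ideal R J \<and> Hs \<noteq> [] \<and> (\<forall>H\<in>set Hs. proper_radical_ideal R H) \<and>
           I = foldl (ideal_prod R) J Hs))"

text \<open>The regular localization at a prime \<open>P\<close> is by definition a subring of the total quotient ring.\<close>

definition regular_localization ::
    "('a, 'm) ring_scheme \<Rightarrow> 'a set \<Rightarrow> ('a, ('a \<times> 'a) set) module" where
  "regular_localization R P =
     (total_quotient_ring R)
       \<lparr>carrier := {fraction R (regular_elements R) a b | a b.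
          a \<in> carrier R \<and> b \<in> carrier R - P \<and> b \<in> regular_elements R}\<rparr>"

end

theory Submission
  imports Defs "HOL-Algebra.Subrings"
begin

text \<open>If \<open>I\<close> is a proper regular ideal of \<open>A\<^sub>S\<close>, then its contraction \<open>I\<^sub>0\<close> to \<open>A\<close> is proper and regular,
  so \<open>I\<^sub>0 = J H\<^sub>1 \<dots> H\<^sub>n\<close>. Extension to \<open>A\<^sub>S\<close> respects products and invertibility and sends a radical
  ideal to a radical ideal or to \<open>A\<^sub>S\<close>; hence \<open>I = J\<^sub>S \<Prod>(H\<^sub>i)\<^sub>S\<close>, and the trivial factors can be dropped.
  To avoid comparing the total quotient rings of \<open>A\<close> and \<open>A\<^sub>S\<close>, invertibility of \<open>J\<close> is replaced by the
  existence of an ideal \<open>K\<close> and a regular element \<open>d\<close> with \<open>J K = d A\<close>. Fraction rings and regular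
  localizations are treated alike, as rings \<open>Q\<close> with an injective homomorphism \<open>h\<close> from \<open>A\<close> that makes \<open>S\<close>
  invertible and such that every element of \<open>Q\<close> has the form \<open>h a / h s\<close>.\<close>

section \<open>Rings of fractions with regular denominators\<close>

lemma regular_elementsD:
  assumes "s \<in> regular_elements R"
  shows "s \<in> carrier R" "\<And>b. b \<in> carrier R \<Longrightarrow> s \<otimes>\<^bsub>R\<^esub> b = \<zero>\<^bsub>R\<^esub> \<Longrightarrow> b = \<zero>\<^bsub>R\<^esub>"
  using assms by (auto simp: regular_elements_def)

context cring
begin

lemma regular_cancel:
  assumes "s \<in> regular_elements R" "a \<in> carrier R" "b \<in> carrier R" "s \<otimes> a = s \<otimes> b"
  shows "a = b"
proof -
  have s: "s \<in> carrier R" using assms(1) by (rule regular_elementsD)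
  have "s \<otimes> (a \<ominus> b) = s \<otimes> a \<ominus> s \<otimes> b"
    using s assms(2,3) by algebra
  also have "\<dots> = \<zero>" using s assms by simp
  finally have "a \<ominus> b = \<zero>" using regular_elementsD(2)[OF assms(1)] assms(2,3) by simp
  then show ?thesis using assms(2,3) by simp
qed

lemma submonoid_regular_elements: "submonoid (regular_elements R) R"
proof
  fix x y assume xy: "x \<in> regular_elements R" "y \<in> regular_elements R"
  note c = xy[THEN regular_elementsD(1)]
  show "x \<otimes> y \<in> regular_elements R"
    unfolding regular_elements_def
  proof (intro CollectI conjI ballI impI)
    fix b assume b: "b \<in> carrier R" "x \<otimes> y \<otimes> b = \<zero>"
    then have "x \<otimes> (y \<otimes> b) = \<zero>" using c by (simp add: m_assoc)
    then show "b = \<zero>"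
      using b c xy[THEN regular_elementsD(2)] by blast
  qed (use c in simp)
qed (auto simp: regular_elements_def)

end

text \<open>Serves both an arbitrary set \<open>S\<close> of regular denominators and the set of all
  regular elements, so the facts on fractions also cover the total quotient ring.\<close>

locale regular_submonoid = cring R + submonoid S R for R (structure) and S +
  assumes regular: "S \<subseteq> regular_elements R"
begin

abbreviation frac where "frac \<equiv> fraction R S"

text \<open>The factor \<open>u\<close> in \<open>frac_rel\<close> is regular and can be cancelled;
  conversely \<open>u = \<one>\<close> serves. Equality of fractions thus becomes plain cross
  multiplication.\<close>

lemma frac_rel_iff:
  "((a, s), (b, t)) \<in> frac_rel R S \<longleftrightarrow>
    a \<in> carrier R \<and> b \<in> carrier R \<and> s \<in> S \<and> t \<in> S \<and> t \<otimes> a = s \<otimes> b"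
proof -
  have "(\<exists>u\<in>S. u \<otimes> (t \<otimes> a \<ominus> s \<otimes> b) = \<zero>) \<longleftrightarrow> t \<otimes> a = s \<otimes> b"
    if [simp]: "a \<in> carrier R" "b \<in> carrier R" "s \<in> S" "t \<in> S"
  proof
    have [simp]: "s \<in> carrier R" "t \<in> carrier R" using that subset by auto
    show "t \<otimes> a = s \<otimes> b" if "\<exists>u\<in>S. u \<otimes> (t \<otimes> a \<ominus> s \<otimes> b) = \<zero>"
    proof -
      from that obtain u where "u \<in> regular_elements R" "u \<otimes> (t \<otimes> a \<ominus> s \<otimes> b) = \<zero>"
        using regular by auto
      from regular_elementsD(2)[OF this(1) _ this(2)] show ?thesis by simp
    qed
    show "\<exists>u\<in>S. u \<otimes> (t \<otimes> a \<ominus> s \<otimes> b) = \<zero>" if "t \<otimes> a = s \<otimes> b"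
      using that by (intro bexI[of _ \<one>]) auto
  qed
  then show ?thesis by (auto simp: frac_rel_def)
qed

lemma carrierI: "s \<in> S \<Longrightarrow> s \<in> carrier R"
  using subset by auto

lemma cancel:
  assumes "s \<in> S" "a \<in> carrier R" "b \<in> carrier R" "s \<otimes> a = s \<otimes> b"
  shows "a = b"
  using assms regular by (auto intro: regular_cancel[of s a b])

lemma equiv_frac_rel: "equiv (carrier R \<times> S) (frac_rel R S)"
proof (rule equivI)
  show "frac_rel R S \<subseteq> (carrier R \<times> S) \<times> carrier R \<times> S"
    by (auto simp: frac_rel_def)
  show "refl_on (carrier R \<times> S) (frac_rel R S)"
    by (auto simp: refl_on_def frac_rel_iff)
  show "sym (frac_rel R S)"
    by (auto simp: sym_def frac_rel_iff)
  show "trans (frac_rel R S)"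
  proof (rule transI, clarify)
    fix a s b t c u
    assume "((a, s), (b, t)) \<in> frac_rel R S" "((b, t), (c, u)) \<in> frac_rel R S"
    then have mem: "a \<in> carrier R" "b \<in> carrier R" "c \<in> carrier R" "s \<in> S" "t \<in> S" "u \<in> S"
      and eq: "t \<otimes> a = s \<otimes> b" "u \<otimes> b = t \<otimes> c"
      by (auto simp: frac_rel_iff)
    note c = mem(1-3) mem(4-6)[THEN carrierI]
    \<comment> \<open>The middle denominator \<open>t\<close> is multiplied in to link the two
      equations and cancelled at the end.\<close>
    have "t \<otimes> (u \<otimes> a) = u \<otimes> (t \<otimes> a)" using c by algebra
    also have "\<dots> = s \<otimes> (u \<otimes> b)" unfolding eq(1) using c by algebra
    also have "\<dots> = t \<otimes> (s \<otimes> c)" unfolding eq(2) using c by algebra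
    finally have "u \<otimes> a = s \<otimes> c" using c mem by (auto intro: cancel[of t "u \<otimes> a" "s \<otimes> c"])
    with mem show "((a, s), (c, u)) \<in> frac_rel R S" by (simp add: frac_rel_iff)
  qed
qed

lemma frac_eq_iff:
  assumes "a \<in> carrier R" "s \<in> S" "b \<in> carrier R" "t \<in> S"
  shows "frac a s = frac b t \<longleftrightarrow> t \<otimes> a = s \<otimes> b"
  unfolding fraction_def
  using eq_equiv_class_iff[OF equiv_frac_rel, of "(a, s)" "(b, t)"] assms
  by (simp add: frac_rel_iff)

section \<open>Arithmetic of fractions\<close>

lemma frac_closed:
  "a \<in> carrier R \<Longrightarrow> s \<in> S \<Longrightarrow> frac a s \<in> carrier (fraction_ring R S)"
  by (auto simp: fraction_ring_def fraction_def intro: quotientI)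

lemma frac_cases:
  assumes "x \<in> carrier (fraction_ring R S)"
  obtains a s where "a \<in> carrier R" "s \<in> S" "x = frac a s"
  using assms by (auto simp: fraction_ring_def fraction_def elim!: quotientE)

text \<open>Multiplication is a union over all representatives. Once \<open>?f\<close> is known to
  respect \<open>frac_rel\<close>, \<open>UN_equiv_class2\<close> collapses the union to the value
  at the chosen pair. \<open>frac_add\<close> and \<open>frac_smult\<close> follow the same
  scheme.\<close>

lemma frac_mult:
  assumes "a \<in> carrier R" "s \<in> S" "b \<in> carrier R" "t \<in> S"
  shows "frac a s \<otimes>\<^bsub>fraction_ring R S\<^esub> frac b t = frac (a \<otimes> b) (s \<otimes> t)"
proof -
  let ?f = "\<lambda>(a, s) (b, t). frac (a \<otimes> b) (s \<otimes> t)"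
  have "congruent2 (frac_rel R S) (frac_rel R S) ?f"
  proof (rule congruent2I', clarify)
    fix a s a' s' b t b' t'
    assume "((a, s), (a', s')) \<in> frac_rel R S" "((b, t), (b', t')) \<in> frac_rel R S"
    then have mem: "a \<in> carrier R" "a' \<in> carrier R" "b \<in> carrier R" "b' \<in> carrier R"
        "s \<in> S" "s' \<in> S" "t \<in> S" "t' \<in> S"
      and eq: "s' \<otimes> a = s \<otimes> a'" "t' \<otimes> b = t \<otimes> b'"
      by (auto simp: frac_rel_iff)
    note c = mem(1-4) mem(5-8)[THEN carrierI]
    have "s' \<otimes> t' \<otimes> (a \<otimes> b) = (s' \<otimes> a) \<otimes> (t' \<otimes> b)" using c by algebra
    also have "\<dots> = s \<otimes> t \<otimes> (a' \<otimes> b')" unfolding eq using c by algebra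
    finally show "frac (a \<otimes> b) (s \<otimes> t) = frac (a' \<otimes> b') (s' \<otimes> t')"
      using c mem by (simp add: frac_eq_iff)
  qed
  from UN_equiv_class2[OF equiv_frac_rel equiv_frac_rel this, of "(a, s)" "(b, t)"] assms
  show ?thesis
    by (simp add: fraction_ring_def fraction_def split_def)
qed

lemma frac_add:
  assumes "a \<in> carrier R" "s \<in> S" "b \<in> carrier R" "t \<in> S"
  shows "frac a s \<oplus>\<^bsub>fraction_ring R S\<^esub> frac b t = frac (t \<otimes> a \<oplus> s \<otimes> b) (s \<otimes> t)"
proof -
  let ?f = "\<lambda>(a, s) (b, t). frac (t \<otimes> a \<oplus> s \<otimes> b) (s \<otimes> t)"
  have "congruent2 (frac_rel R S) (frac_rel R S) ?f"
  proof (rule congruent2I', clarify)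
    fix a s a' s' b t b' t'
    assume "((a, s), (a', s')) \<in> frac_rel R S" "((b, t), (b', t')) \<in> frac_rel R S"
    then have mem: "a \<in> carrier R" "a' \<in> carrier R" "b \<in> carrier R" "b' \<in> carrier R"
        "s \<in> S" "s' \<in> S" "t \<in> S" "t' \<in> S"
      and eq: "s' \<otimes> a = s \<otimes> a'" "t' \<otimes> b = t \<otimes> b'"
      by (auto simp: frac_rel_iff)
    note c = mem(1-4) mem(5-8)[THEN carrierI]
    have "s' \<otimes> t' \<otimes> (t \<otimes> a \<oplus> s \<otimes> b) = t \<otimes> t' \<otimes> (s' \<otimes> a) \<oplus> s \<otimes> s' \<otimes> (t' \<otimes> b)"
      using c by algebra
    also have "\<dots> = s \<otimes> t \<otimes> (t' \<otimes> a' \<oplus> s' \<otimes> b')" unfolding eq using c by algebra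
    finally show "frac (t \<otimes> a \<oplus> s \<otimes> b) (s \<otimes> t) = frac (t' \<otimes> a' \<oplus> s' \<otimes> b') (s' \<otimes> t')"
      using c mem by (simp add: frac_eq_iff)
  qed
  from UN_equiv_class2[OF equiv_frac_rel equiv_frac_rel this, of "(a, s)" "(b, t)"] assms
  show ?thesis
    by (simp add: fraction_ring_def fraction_def split_def)
qed

lemma frac_smult:
  assumes "r \<in> carrier R" "a \<in> carrier R" "s \<in> S"
  shows "r \<odot>\<^bsub>fraction_ring R S\<^esub> frac a s = frac (r \<otimes> a) s"
proof -
  let ?f = "\<lambda>(a, s). frac (r \<otimes> a) s"
  have "congruent (frac_rel R S) ?f"
  proof (rule congruentI, clarify)
    fix a s a' s' 
    assume "((a, s), (a', s')) \<in> frac_rel R S"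
    then have mem: "a \<in> carrier R" "a' \<in> carrier R" "s \<in> S" "s' \<in> S"
      and eq: "s' \<otimes> a = s \<otimes> a'"
      by (auto simp: frac_rel_iff)
    note c = mem(1-2) mem(3-4)[THEN carrierI]
    have "s' \<otimes> (r \<otimes> a) = r \<otimes> (s' \<otimes> a)" using c assms by algebra
    also have "\<dots> = s \<otimes> (r \<otimes> a')" unfolding eq using c assms by algebra
    finally show "frac (r \<otimes> a) s = frac (r \<otimes> a') s'"
      using c mem assms by (simp add: frac_eq_iff)
  qed
  from UN_equiv_class[OF equiv_frac_rel this, of "(a, s)"] assms
  show ?thesis
    by (simp add: fraction_ring_def fraction_def split_def)
qed

lemma fraction_ring_one: "\<one>\<^bsub>fraction_ring R S\<^esub> = frac \<one> \<one>"
  and fraction_ring_zero: "\<zero>\<^bsub>fraction_ring R S\<^esub> = frac \<zero> \<one>"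
  by (simp_all add: fraction_ring_def)

text \<open>Serves the additive inverses: the sum of \<open>-a/s\<close> and \<open>a/s\<close>
  comes out with denominator \<open>s \<otimes> s\<close> instead of \<open>\<one>\<close>.\<close>

lemma frac_zero: "s \<in> S \<Longrightarrow> frac \<zero> s = \<zero>\<^bsub>fraction_ring R S\<^esub>"
  by (simp add: fraction_ring_zero frac_eq_iff carrierI)

lemmas frac_simps = frac_mult frac_add frac_eq_iff fraction_ring_one fraction_ring_zero

text \<open>Writing elements as fractions turns each axiom into identities in \<open>R\<close>
  between numerators and denominators.\<close>

lemma cring_fraction_ring: "cring (fraction_ring R S)"
proof (intro cringI abelian_groupI comm_monoidI)
  let ?Q = "fraction_ring R S"
  show "\<one>\<^bsub>?Q\<^esub> \<in> carrier ?Q" "\<zero>\<^bsub>?Q\<^esub> \<in> carrier ?Q"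
    by (simp_all add: fraction_ring_one fraction_ring_zero frac_closed)
  fix x assume "x \<in> carrier ?Q"
  then obtain a s where x: "x = frac a s" and as: "a \<in> carrier R" "s \<in> S"
    by (rule frac_cases)
  note [simp] = as carrierI[OF as(2)]
  show "\<one>\<^bsub>?Q\<^esub> \<otimes>\<^bsub>?Q\<^esub> x = x" "\<zero>\<^bsub>?Q\<^esub> \<oplus>\<^bsub>?Q\<^esub> x = x"
    by (simp_all add: x frac_simps)
  have "frac (\<ominus> a) s \<oplus>\<^bsub>?Q\<^esub> x = \<zero>\<^bsub>?Q\<^esub>"
    by (simp add: x frac_add r_minus l_neg frac_zero)
  then show "\<exists>y\<in>carrier ?Q. y \<oplus>\<^bsub>?Q\<^esub> x = \<zero>\<^bsub>?Q\<^esub>"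
    by (intro bexI[of _ "frac (\<ominus> a) s"]) (simp_all add: frac_closed)
  fix y assume "y \<in> carrier ?Q"
  then obtain b t where y: "y = frac b t" and bt: "b \<in> carrier R" "t \<in> S"
    by (rule frac_cases)
  note [simp] = bt carrierI[OF bt(2)]
  show "x \<otimes>\<^bsub>?Q\<^esub> y \<in> carrier ?Q" "x \<oplus>\<^bsub>?Q\<^esub> y \<in> carrier ?Q"
    by (simp_all add: x y frac_simps frac_closed)
  show "x \<otimes>\<^bsub>?Q\<^esub> y = y \<otimes>\<^bsub>?Q\<^esub> x" "x \<oplus>\<^bsub>?Q\<^esub> y = y \<oplus>\<^bsub>?Q\<^esub> x"
    by (simp_all add: x y frac_simps m_comm a_comm)
  fix z assume "z \<in> carrier ?Q"
  then obtain c u where z: "z = frac c u" and cu: "c \<in> carrier R" "u \<in> S"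
    by (rule frac_cases)
  note [simp] = cu carrierI[OF cu(2)]
  show "x \<otimes>\<^bsub>?Q\<^esub> y \<otimes>\<^bsub>?Q\<^esub> z = x \<otimes>\<^bsub>?Q\<^esub> (y \<otimes>\<^bsub>?Q\<^esub> z)"
    by (simp add: x y z frac_mult m_assoc)
  show "x \<oplus>\<^bsub>?Q\<^esub> y \<oplus>\<^bsub>?Q\<^esub> z = x \<oplus>\<^bsub>?Q\<^esub> (y \<oplus>\<^bsub>?Q\<^esub> z)"
    apply (simp add: x y z frac_simps)
    using as(1) bt(1) cu(1) carrierI[OF as(2)] carrierI[OF bt(2)] carrierI[OF cu(2)]
    apply algebra done
  show "(x \<oplus>\<^bsub>?Q\<^esub> y) \<otimes>\<^bsub>?Q\<^esub> z = x \<otimes>\<^bsub>?Q\<^esub> z \<oplus>\<^bsub>?Q\<^esub> y \<otimes>\<^bsub>?Q\<^esub> z"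
    apply (simp add: x y z frac_simps)
    using as(1) bt(1) cu(1) carrierI[OF as(2)] carrierI[OF bt(2)] carrierI[OF cu(2)]
    apply algebra done
qed

end

section \<open>Products and cancellation of ideals\<close>

text \<open>Each further factor can only shrink the product. The lemma is later applied with the
  accumulator \<open>J H\<close> that already contains the first factor.\<close>

lemma (in ring) foldl_ideal_prod_subset:
  assumes "ideal J R" "\<forall>H\<in>set Hs. ideal H R"
  shows "foldl (ideal_prod R) J Hs \<subseteq> J"
  using assms
proof (induction Hs arbitrary: J)
  case (Cons H Hs)
  then have "foldl (ideal_prod R) (J \<cdot> H) Hs \<subseteq> J \<cdot> H"
    by (auto simp: ideal_prod_is_ideal)
  then show ?case using ideal_prod_inter[of J H] Cons.prems by auto
qed simp

text \<open>The unit ideal is neutral for products, so dropping such factors leaves the accumulator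
  unchanged.\<close>

lemma (in ring) foldl_ideal_prod_filter_proper:
  assumes "ideal J R" "\<forall>H\<in>set Hs. ideal H R"
  shows "foldl (ideal_prod R) J (filter (\<lambda>H. H \<noteq> carrier R) Hs) = foldl (ideal_prod R) J Hs"
  using assms
  by (induction Hs arbitrary: J) (auto simp: ideal_prod_is_ideal ideal_prod_one)

lemma ideal_prod_mono:
  "I \<subseteq> I' \<Longrightarrow> J \<subseteq> J' \<Longrightarrow> x \<in> ideal_prod R I J \<Longrightarrow> x \<in> ideal_prod R I' J'"
  by (erule ideal_prod.induct) (auto intro: ideal_prod.intros)

text \<open>A generator \<open>(r d) y\<close> equals \<open>d (r y)\<close> with \<open>r y\<close>
  in \<open>H\<close>, and \<open>d\<close> factors out of sums.\<close>

lemma (in cring) ideal_prod_PIdl_subset: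
  assumes "ideal H R" "d \<in> carrier R" "x \<in> (PIdl d) \<cdot> H"
  shows "\<exists>y\<in>H. x = d \<otimes> y"
  using assms(3)
proof induction
  case (prod i y)
  then obtain r where r: "r \<in> carrier R" "i = r \<otimes> d" by (auto simp: cgenideal_def)
  have y: "y \<in> carrier R" using prod(2) ideal.Icarr[OF assms(1)] by auto
  have "r \<otimes> y \<in> H" using ideal.I_l_closed[OF assms(1) prod(2) r(1)] .
  moreover have "i \<otimes> y = d \<otimes> (r \<otimes> y)" unfolding r(2) using r(1) y assms(2) by algebra
  ultimately show ?case by blast
next
  case (sum s1 s2)
  then obtain y1 y2 where y: "y1 \<in> H" "y2 \<in> H" "s1 = d \<otimes> y1" "s2 = d \<otimes> y2" by auto
  then have "y1 \<oplus> y2 \<in> H" using assms(1) by (simp add: additive_subgroup.a_closed ideal_def)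
  moreover have "s1 \<oplus> s2 = d \<otimes> (y1 \<oplus> y2)"
    using y assms(2) ideal.Icarr[OF assms(1)] by (simp add: r_distr)
  ultimately show ?case by blast
qed

text \<open>From \<open>J \<subseteq> J H\<close> it follows that \<open>d\<close> lies in
  \<open>J K \<subseteq> (J H) K = (J K) H = d H\<close>. So \<open>d = d y\<close> with
  \<open>y\<close> in \<open>H\<close>, and cancelling the regular \<open>d\<close> gives
  \<open>y = 1\<close>.\<close>

lemma (in cring) invertible_ideal_cancel:
  assumes "ideal J R" "ideal K R" "ideal H R" "d \<in> regular_elements R"
    and JK: "J \<cdot> K = PIdl d" and sub: "J \<subseteq> J \<cdot> H"
  shows "H = carrier R"
proof -
  have d: "d \<in> carrier R" using assms(4) by (rule regular_elementsD)
  have "d \<in> J \<cdot> K" using JK cgenideal_self[OF d] by simp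
  then have "d \<in> J \<cdot> H \<cdot> K" using ideal_prod_mono[OF sub order_refl] by blast
  also have "J \<cdot> H \<cdot> K = (PIdl d) \<cdot> H"
    using assms(1-3) JK by (metis ideal_prod_assoc ideal_prod_commute)
  finally obtain y where y: "y \<in> H" "d = d \<otimes> y"
    using ideal_prod_PIdl_subset[OF assms(3) d] by blast
  have "y = \<one>"
  proof (rule regular_cancel[OF assms(4)])
    show "y \<in> carrier R" using ideal.Icarr[OF assms(3)] y by simp
  qed (use y d in auto)
  with y show ?thesis using ideal.one_imp_carrier[OF assms(3)] by simp
qed

section \<open>Extension and contraction of ideals\<close>

text \<open>Fractions are handled in the multiplied-out form \<open>h s x = h a\<close>, which
  avoids inverses in \<open>Q\<close>. Regularity of the denominators is implicit: an injective
  \<open>h\<close> that sends \<open>s\<close> to a unit forces \<open>s\<close> to be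
  regular.\<close>

locale localization = R: cring R + Q: cring Q + S: submonoid S R
  for R (structure) and Q (structure) and S +
  fixes h
  assumes homh: "h \<in> ring_hom R Q"
    and inj: "inj_on h (carrier R)"
    and units: "\<And>s. s \<in> S \<Longrightarrow> h s \<in> Units Q"
    and denominator: "\<And>x. x \<in> carrier Q \<Longrightarrow> \<exists>s\<in>S. \<exists>a\<in>carrier R. h s \<otimes>\<^bsub>Q\<^esub> x = h a"
begin

sublocale hom: ring_hom_cring R Q h
  by unfold_locales (rule homh)

lemma S_carrier: "s \<in> S \<Longrightarrow> s \<in> carrier R"
  using S.subset by auto

lemma h_eq_iff: "a \<in> carrier R \<Longrightarrow> b \<in> carrier R \<Longrightarrow> h a = h b \<longleftrightarrow> a = b"
  using inj by (auto dest: inj_onD)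

lemma denominatorE:
  assumes "x \<in> carrier Q"
  obtains s a where "s \<in> S" "a \<in> carrier R" "h s \<otimes>\<^bsub>Q\<^esub> x = h a"
  using denominator[OF assms] by blast

lemma h_cancel:
  assumes "s \<in> S" "x \<in> carrier Q" "y \<in> carrier Q"
  shows "h s \<otimes>\<^bsub>Q\<^esub> x = h s \<otimes>\<^bsub>Q\<^esub> y \<longleftrightarrow> x = y"
  using assms Q.Units_l_cancel[OF units] by auto

lemma divide:
  assumes "s \<in> S" "x \<in> carrier Q"
  shows "\<exists>y\<in>carrier Q. h s \<otimes>\<^bsub>Q\<^esub> y = x"
proof (rule bexI)
  note u = units[OF assms(1)]
  show "h s \<otimes>\<^bsub>Q\<^esub> (inv\<^bsub>Q\<^esub> h s \<otimes>\<^bsub>Q\<^esub> x) = x"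
    using u assms by (simp add: Q.m_assoc[symmetric] S_carrier)
qed (use assms units in simp)

text \<open>Since \<open>h s\<close> is a unit, membership in an ideal of \<open>Q\<close> can be
  tested after clearing a denominator.\<close>

lemma ideal_unit_cancel:
  assumes "ideal I Q" "s \<in> S" "x \<in> carrier Q" "h s \<otimes>\<^bsub>Q\<^esub> x \<in> I"
  shows "x \<in> I"
proof -
  note u = units[OF assms(2)]
  have "inv\<^bsub>Q\<^esub> h s \<otimes>\<^bsub>Q\<^esub> (h s \<otimes>\<^bsub>Q\<^esub> x) \<in> I"
    using ideal.I_l_closed[OF assms(1,4)] u by simp
  then show ?thesis
    using u assms by (simp add: Q.m_assoc[symmetric] S_carrier)
qed

text \<open>For an ideal \<open>I\<close> this is the extended ideal \<open>I Q\<close>, described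
  as the set of fractions with a numerator in \<open>I\<close>; common denominators absorb the
  finite sums.\<close>

definition ext :: "'a set \<Rightarrow> 'c set" where
  "ext I = {x \<in> carrier Q. \<exists>s\<in>S. h s \<otimes>\<^bsub>Q\<^esub> x \<in> h ` I}"

lemma extI: "x \<in> carrier Q \<Longrightarrow> s \<in> S \<Longrightarrow> i \<in> I \<Longrightarrow> h s \<otimes>\<^bsub>Q\<^esub> x = h i \<Longrightarrow> x \<in> ext I"
  unfolding ext_def by auto

lemma extE:
  assumes "x \<in> ext I"
  obtains s i where "x \<in> carrier Q" "s \<in> S" "i \<in> I" "h s \<otimes>\<^bsub>Q\<^esub> x = h i"
  using assms unfolding ext_def by auto

lemma h_in_ext: "ideal I R \<Longrightarrow> i \<in> I \<Longrightarrow> h i \<in> ext I"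
  by (rule extI[of _ \<one>]) (auto dest: ideal.Icarr)

text \<open>The usual rule for \<open>a/s + b/t\<close> in multiplied-out form; the next lemma is
  the one for products.\<close>

lemma h_add_fractions:
  assumes "x \<in> carrier Q" "y \<in> carrier Q" "s \<in> S" "t \<in> S" "a \<in> carrier R" "b \<in> carrier R"
    and eq: "h s \<otimes>\<^bsub>Q\<^esub> x = h a" "h t \<otimes>\<^bsub>Q\<^esub> y = h b"
  shows "h (s \<otimes> t) \<otimes>\<^bsub>Q\<^esub> (x \<oplus>\<^bsub>Q\<^esub> y) = h (t \<otimes> a \<oplus> s \<otimes> b)"
proof -
  have st: "s \<in> carrier R" "t \<in> carrier R" using assms S_carrier by auto
  note c = assms(1,2,5,6) st st[THEN hom.hom_closed]
  have "h (s \<otimes> t) \<otimes>\<^bsub>Q\<^esub> (x \<oplus>\<^bsub>Q\<^esub> y) = h s \<otimes>\<^bsub>Q\<^esub> h t \<otimes>\<^bsub>Q\<^esub> (x \<oplus>\<^bsub>Q\<^esub> y)"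
    using c by simp
  also have "\<dots> = h t \<otimes>\<^bsub>Q\<^esub> (h s \<otimes>\<^bsub>Q\<^esub> x) \<oplus>\<^bsub>Q\<^esub> h s \<otimes>\<^bsub>Q\<^esub> (h t \<otimes>\<^bsub>Q\<^esub> y)"
    using c by algebra
  also have "\<dots> = h (t \<otimes> a \<oplus> s \<otimes> b)" unfolding eq using c by simp
  finally show ?thesis .
qed

lemma h_mult_fractions:
  assumes "x \<in> carrier Q" "y \<in> carrier Q" "s \<in> S" "t \<in> S" "a \<in> carrier R" "b \<in> carrier R"
    and eq: "h s \<otimes>\<^bsub>Q\<^esub> x = h a" "h t \<otimes>\<^bsub>Q\<^esub> y = h b"
  shows "h (s \<otimes> t) \<otimes>\<^bsub>Q\<^esub> (x \<otimes>\<^bsub>Q\<^esub> y) = h (a \<otimes> b)"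
proof -
  have st: "s \<in> carrier R" "t \<in> carrier R" using assms S_carrier by auto
  note c = assms(1,2,5,6) st st[THEN hom.hom_closed]
  have "h (s \<otimes> t) \<otimes>\<^bsub>Q\<^esub> (x \<otimes>\<^bsub>Q\<^esub> y) = h s \<otimes>\<^bsub>Q\<^esub> h t \<otimes>\<^bsub>Q\<^esub> (x \<otimes>\<^bsub>Q\<^esub> y)"
    using c by simp
  also have "\<dots> = (h s \<otimes>\<^bsub>Q\<^esub> x) \<otimes>\<^bsub>Q\<^esub> (h t \<otimes>\<^bsub>Q\<^esub> y)"
    using c by algebra
  also have "\<dots> = h (a \<otimes> b)" unfolding eq using c by simp
  finally show ?thesis .
qed

lemma ideal_ext:
  assumes "ideal I R"
  shows "ideal (ext I) Q"
proof -
  interpret I: ideal I R by fact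
  have mult: "y \<otimes>\<^bsub>Q\<^esub> x \<in> ext I" if x: "x \<in> ext I" and y: "y \<in> carrier Q" for x y
  proof -
    from x obtain s i where s: "x \<in> carrier Q" "s \<in> S" "i \<in> I" "h s \<otimes>\<^bsub>Q\<^esub> x = h i" by (rule extE)
    from y obtain t a where t: "t \<in> S" "a \<in> carrier R" "h t \<otimes>\<^bsub>Q\<^esub> y = h a" by (rule denominatorE)
    show ?thesis
      using h_mult_fractions[OF y s(1) t(1) s(2) t(2) _ t(3) s(4)] s t y I.I_l_closed[of i a] I.Icarr
      by (intro extI[of _ "t \<otimes> s" "a \<otimes> i"]) auto
  qed
  show ?thesis
  proof (rule idealI)
    show "subgroup (ext I) (add_monoid Q)"
    proof (rule Q.add.subgroupI)
      show "ext I \<subseteq> carrier Q" by (auto simp: ext_def)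
      show "ext I \<noteq> {}" using h_in_ext[OF assms I.zero_closed] by auto
      fix x assume x: "x \<in> ext I"
      then have c: "x \<in> carrier Q" by (auto elim: extE)
      show "\<ominus>\<^bsub>Q\<^esub> x \<in> ext I"
        using mult[OF x, of "\<ominus>\<^bsub>Q\<^esub> \<one>\<^bsub>Q\<^esub>"] c by (simp add: Q.l_minus)
      fix y assume y: "y \<in> ext I"
      from x obtain s i where s: "x \<in> carrier Q" "s \<in> S" "i \<in> I" "h s \<otimes>\<^bsub>Q\<^esub> x = h i"
        by (rule extE)
      from y obtain t j where t: "y \<in> carrier Q" "t \<in> S" "j \<in> I" "h t \<otimes>\<^bsub>Q\<^esub> y = h j"
        by (rule extE)
      have "t \<otimes> i \<oplus> s \<otimes> j \<in> I"
        using s t by (simp add: I.a_closed I.I_l_closed S_carrier)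
      then show "x \<oplus>\<^bsub>Q\<^esub> y \<in> ext I"
        using h_add_fractions[OF s(1) t(1) s(2) t(2) _ _ s(4) t(4)] s t I.Icarr
        by (intro extI[of _ "s \<otimes> t" "t \<otimes> i \<oplus> s \<otimes> j"]) auto
    qed
  next
    fix x y assume xy: "x \<in> ext I" "y \<in> carrier Q"
    show "y \<otimes>\<^bsub>Q\<^esub> x \<in> ext I" using mult[OF xy] .
    moreover have "x \<in> carrier Q" using xy by (auto elim: extE)
    ultimately show "x \<otimes>\<^bsub>Q\<^esub> y \<in> ext I" using xy by (simp add: Q.m_comm)
  qed (rule Q.ring_axioms)
qed

definition contraction :: "'c set \<Rightarrow> 'a set" where
  "contraction I = {a \<in> carrier R. h a \<in> I}"

lemma ideal_contraction:
  assumes "ideal I Q"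
  shows "ideal (contraction I) R"
proof -
  interpret I: ideal I Q by fact
  show ?thesis
  proof (rule idealI)
    show "subgroup (contraction I) (add_monoid R)"
      by (rule R.add.subgroupI)
        (auto simp: contraction_def I.a_inv_closed intro!: exI[of _ \<zero>] I.a_closed)
  qed (auto simp: contraction_def I.I_l_closed I.I_r_closed R.ring_axioms)
qed

text \<open>For \<open>x = a/s\<close> in \<open>I\<close> the numerator \<open>a\<close> is in the
  contraction because \<open>h a = h s x\<close>; conversely the unit \<open>h s\<close> cancels.
  Hence every ideal of \<open>Q\<close> is extended from \<open>R\<close>.\<close>

lemma ext_contraction:
  assumes "ideal I Q"
  shows "ext (contraction I) = I"
proof
  show "ext (contraction I) \<subseteq> I"
    by (auto simp: contraction_def elim!: extE intro: ideal_unit_cancel[OF assms])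
  show "I \<subseteq> ext (contraction I)"
  proof
    fix x assume x: "x \<in> I"
    then have c: "x \<in> carrier Q" using ideal.Icarr[OF assms] by auto
    then obtain s a where s: "s \<in> S" "a \<in> carrier R" "h s \<otimes>\<^bsub>Q\<^esub> x = h a" by (rule denominatorE)
    then have "h a \<in> I" using ideal.I_l_closed[OF assms x, of "h s"] S_carrier by auto
    with s c show "x \<in> ext (contraction I)" by (intro extI[of x s a]) (auto simp: contraction_def)
  qed
qed

text \<open>Both inclusions go by induction over the finite sums in a product. A numerator in
  \<open>I J\<close> is mapped into the product of the extensions, after which its denominator
  cancels; in the other direction numerators and denominators of two fractions are
  multiplied.\<close>

lemma ext_ideal_prod:
  assumes I: "ideal I R" and J: "ideal J R"
  shows "ext (ideal_prod R I J) = ideal_prod Q (ext I) (ext J)"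
proof (intro equalityI subsetI)
  have IJ: "ideal (ideal_prod Q (ext I) (ext J)) Q"
    using assms by (simp add: Q.ideal_prod_is_ideal ideal_ext)
  fix x assume "x \<in> ext (ideal_prod R I J)"
  then obtain s k where s: "x \<in> carrier Q" "s \<in> S" "k \<in> ideal_prod R I J" "h s \<otimes>\<^bsub>Q\<^esub> x = h k"
    by (rule extE)
  from s(3) have "h k \<in> ideal_prod Q (ext I) (ext J)"
  proof induction
    case (prod i j)
    then show ?case
      using ideal.Icarr[OF I] ideal.Icarr[OF J] I J by (simp add: ideal_prod.prod h_in_ext)
  next
    case (sum s1 s2)
    then show ?case
      using R.ideal_prod_in_carrier[OF I J] by (auto simp: subset_iff intro!: ideal_prod.sum)
  qed
  with s show "x \<in> ideal_prod Q (ext I) (ext J)"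
    using ideal_unit_cancel[OF IJ s(2,1)] by simp
next
  have IJ: "ideal (ext (ideal_prod R I J)) Q"
    using assms by (simp add: R.ideal_prod_is_ideal ideal_ext)
  fix x assume "x \<in> ideal_prod Q (ext I) (ext J)"
  then show "x \<in> ext (ideal_prod R I J)"
  proof induction
    case (prod x y)
    from prod(1) obtain s i where s: "x \<in> carrier Q" "s \<in> S" "i \<in> I" "h s \<otimes>\<^bsub>Q\<^esub> x = h i"
      by (rule extE)
    from prod(2) obtain t j where t: "y \<in> carrier Q" "t \<in> S" "j \<in> J" "h t \<otimes>\<^bsub>Q\<^esub> y = h j"
      by (rule extE)
    show ?case
      using h_mult_fractions[OF s(1) t(1) s(2) t(2) _ _ s(4) t(4)] s t ideal.Icarr[OF I] ideal.Icarr[OF J]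
      by (intro extI[of _ "s \<otimes> t" "i \<otimes> j"]) (auto intro: ideal_prod.prod)
  next
    case (sum s1 s2)
    then show ?case using IJ by (simp add: additive_subgroup.a_closed ideal_def)
  qed
qed

lemma ext_foldl_ideal_prod:
  assumes "ideal J R" "\<forall>H\<in>set Hs. ideal H R"
  shows "ext (foldl (ideal_prod R) J Hs) = foldl (ideal_prod Q) (ext J) (map ext Hs)"
  using assms
  by (induction Hs arbitrary: J) (simp_all add: R.ideal_prod_is_ideal ext_ideal_prod)

lemma ext_PIdl:
  assumes "d \<in> carrier R"
  shows "ext (PIdl d) = PIdl\<^bsub>Q\<^esub> (h d)"
proof
  show "PIdl\<^bsub>Q\<^esub> (h d) \<subseteq> ext (PIdl d)"
    using assms by (intro Q.cgenideal_minimal ideal_ext h_in_ext R.cgenideal_ideal R.cgenideal_self)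
  show "ext (PIdl d) \<subseteq> PIdl\<^bsub>Q\<^esub> (h d)"
  proof
    fix x assume "x \<in> ext (PIdl d)"
    then obtain s i where s: "x \<in> carrier Q" "s \<in> S" "i \<in> PIdl d" "h s \<otimes>\<^bsub>Q\<^esub> x = h i"
      by (rule extE)
    then have "h i \<in> PIdl\<^bsub>Q\<^esub> (h d)" using assms by (auto simp: cgenideal_def)
    with s show "x \<in> PIdl\<^bsub>Q\<^esub> (h d)"
      using ideal_unit_cancel[OF Q.cgenideal_ideal s(2,1)] assms by simp
  qed
qed

section \<open>Regular elements and radical ideals under localization\<close>

lemma regular_h:
  assumes "a \<in> regular_elements R"
  shows "h a \<in> regular_elements Q"
  unfolding regular_elements_def
proof (intro CollectI conjI ballI impI)
  have a: "a \<in> carrier R" using assms by (rule regular_elementsD)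
  then show "h a \<in> carrier Q" by simp
  fix x assume x: "x \<in> carrier Q" "h a \<otimes>\<^bsub>Q\<^esub> x = \<zero>\<^bsub>Q\<^esub>"
  from x(1) obtain s b where s: "s \<in> S" "b \<in> carrier R" "h s \<otimes>\<^bsub>Q\<^esub> x = h b" by (rule denominatorE)
  note c = x(1) a hom.hom_closed[OF a] hom.hom_closed[OF S_carrier[OF s(1)]]
  \<comment> \<open>With \<open>x = b/s\<close>, the relation \<open>h a x = 0\<close> clears to
    \<open>a \<otimes> b = \<zero>\<close> in \<open>R\<close>, where regularity of \<open>a\<close>
    applies.\<close>
  have "h (a \<otimes> b) = h a \<otimes>\<^bsub>Q\<^esub> (h s \<otimes>\<^bsub>Q\<^esub> x)" using a s by simp
  also have "\<dots> = h s \<otimes>\<^bsub>Q\<^esub> (h a \<otimes>\<^bsub>Q\<^esub> x)" using c by algebra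
  also have "\<dots> = h \<zero>" using x c by simp
  finally have "a \<otimes> b = \<zero>" using a s by (simp add: h_eq_iff del: hom.hom_mult hom.hom_zero)
  then have "b = \<zero>" using regular_elementsD(2)[OF assms] s by simp
  then have "h s \<otimes>\<^bsub>Q\<^esub> x = h s \<otimes>\<^bsub>Q\<^esub> \<zero>\<^bsub>Q\<^esub>" using s c by simp
  then show "x = \<zero>\<^bsub>Q\<^esub>" using h_cancel[OF s(1) x(1)] by simp
qed

text \<open>If \<open>a b = 0\<close>, then \<open>h s (x h b) = h (a b) = 0\<close>; cancelling the
  unit \<open>h s\<close> and the regular \<open>x\<close> gives \<open>h b = 0\<close>. This makes
  contractions of regular ideals regular.\<close>

lemma regular_numerator:
  assumes "x \<in> regular_elements Q" "s \<in> S" "a \<in> carrier R" "h s \<otimes>\<^bsub>Q\<^esub> x = h a"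
  shows "a \<in> regular_elements R"
  unfolding regular_elements_def
proof (intro CollectI conjI ballI impI)
  have x: "x \<in> carrier Q" using assms(1) by (rule regular_elementsD)
  fix b assume b: "b \<in> carrier R" "a \<otimes> b = \<zero>"
  note c = x b(1) hom.hom_closed[OF b(1)] hom.hom_closed[OF S_carrier[OF assms(2)]]
  have "h s \<otimes>\<^bsub>Q\<^esub> (x \<otimes>\<^bsub>Q\<^esub> h b) = h a \<otimes>\<^bsub>Q\<^esub> h b"
    unfolding assms(4)[symmetric] using c by (simp add: Q.m_assoc)
  also have "\<dots> = h (a \<otimes> b)" using assms(3) b(1) by simp
  also have "\<dots> = h s \<otimes>\<^bsub>Q\<^esub> \<zero>\<^bsub>Q\<^esub>" unfolding b(2) using c by simp
  finally have "x \<otimes>\<^bsub>Q\<^esub> h b = \<zero>\<^bsub>Q\<^esub>"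
    by (rule h_cancel[OF assms(2), THEN iffD1, rotated 2]) (use c in simp_all)
  from regular_elementsD(2)[OF assms(1) _ this] have "h b = h \<zero>" using c by simp
  then show "b = \<zero>" using b h_eq_iff by blast
qed (rule assms)

text \<open>Let \<open>x = a/s\<close> and let its \<open>n\<close>-th power be \<open>k/t\<close>
  with \<open>k\<close> in \<open>H\<close>. Comparing the two fractions puts
  \<open>t a^n = s^n k\<close> into \<open>H\<close>, hence also \<open>(t a)^n\<close>. As
  \<open>H\<close> is radical, \<open>t a\<close> lies in \<open>H\<close>, and
  \<open>x = (t a)/(t s)\<close>.\<close>

lemma radical_ext:
  assumes H: "ideal H R" and rad: "ideal_radical R H = H"
  shows "ideal_radical Q (ext H) = ext H"
proof
  interpret H: ideal H R by fact
  show "ext H \<subseteq> ideal_radical Q (ext H)"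
    by (auto simp: ideal_radical_def elim: extE intro!: exI[of _ "1::nat"]) (auto simp: ext_def)
  show "ideal_radical Q (ext H) \<subseteq> ext H"
  proof
    fix x assume "x \<in> ideal_radical Q (ext H)"
    then obtain n :: nat where x: "x \<in> carrier Q" "n > 0" "x [^]\<^bsub>Q\<^esub> n \<in> ext H"
      by (auto simp: ideal_radical_def)
    from x(3) obtain t k where t: "t \<in> S" "k \<in> H" "h t \<otimes>\<^bsub>Q\<^esub> x [^]\<^bsub>Q\<^esub> n = h k" by (rule extE)
    from x(1) obtain s a where s: "s \<in> S" "a \<in> carrier R" "h s \<otimes>\<^bsub>Q\<^esub> x = h a"
      by (rule denominatorE)
    have st: "s \<in> carrier R" "t \<in> carrier R" using s t S_carrier by auto
    have k: "k \<in> carrier R" using t by simp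
    have xn: "x [^]\<^bsub>Q\<^esub> n \<in> carrier Q" and sn: "s [^] n \<in> carrier R" using x st by auto
    note c = xn hom.hom_closed[OF sn] hom.hom_closed[OF st(2)]
    have "h (t \<otimes> a [^] n) = h t \<otimes>\<^bsub>Q\<^esub> (h s \<otimes>\<^bsub>Q\<^esub> x) [^]\<^bsub>Q\<^esub> n"
      using s st by (simp add: hom.ring.hom_nat_pow)
    also have "\<dots> = h t \<otimes>\<^bsub>Q\<^esub> (h (s [^] n) \<otimes>\<^bsub>Q\<^esub> x [^]\<^bsub>Q\<^esub> n)"
      using st x by (simp add: Q.nat_pow_distrib hom.ring.hom_nat_pow)
    also have "\<dots> = h (s [^] n) \<otimes>\<^bsub>Q\<^esub> (h t \<otimes>\<^bsub>Q\<^esub> x [^]\<^bsub>Q\<^esub> n)"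
      using c by algebra
    also have "\<dots> = h (s [^] n \<otimes> k)"
      unfolding t(3) using sn k by simp
    finally have "t \<otimes> a [^] n = s [^] n \<otimes> k"
      using st s k h_eq_iff by (meson R.m_closed R.nat_pow_closed)
    then have tan: "t \<otimes> a [^] n \<in> H" using t sn H.I_l_closed by simp
    \<comment> \<open>Because \<open>n > 0\<close>, one factor \<open>t\<close> can be split off
      \<open>t [^] n\<close> and joined with \<open>a [^] n\<close>.\<close>
    obtain m where m: "n = Suc m" using x(2) by (cases n) auto
    have "(t \<otimes> a) [^] n = t [^] n \<otimes> a [^] n" using st s by (simp add: R.nat_pow_distrib)
    also have "\<dots> = t [^] m \<otimes> (t \<otimes> a [^] n)" using st s by (simp add: m R.m_assoc)
    also have "\<dots> \<in> H" using tan st H.I_l_closed by simp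
    finally have "t \<otimes> a \<in> ideal_radical R H" using st s x(2) by (auto simp: ideal_radical_def)
    then have "t \<otimes> a \<in> H" using rad by simp
    then show "x \<in> ext H"
      using x s st t by (intro extI[of x "t \<otimes> s" "t \<otimes> a"]) (auto simp: Q.m_assoc)
  qed
qed

lemma proper_radical_ext:
  assumes "proper_radical_ideal R H" "ext H \<noteq> carrier Q"
  shows "proper_radical_ideal Q (ext H)"
  using assms by (simp add: proper_radical_ideal_def ideal_ext radical_ext)

end

section \<open>Invertible ideals\<close>

context localization
begin

text \<open>This set is the preimage under \<open>h\<close> of \<open>d J'\<close>: the elements of
  the submodule \<open>J'\<close> with denominator \<open>d\<close> cleared. It supplies the
  integral partner \<open>K\<close> of \<open>J\<close>.\<close>

lemma ideal_denominators:
  assumes J': "subgroup J' (add_monoid Q)"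
    and smult: "\<And>r x. r \<in> carrier R \<Longrightarrow> x \<in> J' \<Longrightarrow> h r \<otimes>\<^bsub>Q\<^esub> x \<in> J'"
    and d: "d \<in> S"
  shows "ideal {k \<in> carrier R. \<exists>y\<in>J'. h d \<otimes>\<^bsub>Q\<^esub> y = h k} R" (is "ideal ?K R")
proof (rule idealI)
  interpret J': subgroup J' "add_monoid Q" by fact
  have J'c: "y \<in> carrier Q" if "y \<in> J'" for y using J'.subset that by auto
  have d': "h d \<in> carrier Q" using d S_carrier by simp
  have mult: "r \<otimes> k \<in> ?K" if k: "k \<in> ?K" and r: "r \<in> carrier R" for r k
  proof -
    from k obtain y where y: "k \<in> carrier R" "y \<in> J'" "h d \<otimes>\<^bsub>Q\<^esub> y = h k" by blast
    note c = J'c[OF y(2)] d' hom.hom_closed[OF r]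
    have "h d \<otimes>\<^bsub>Q\<^esub> (h r \<otimes>\<^bsub>Q\<^esub> y) = h r \<otimes>\<^bsub>Q\<^esub> (h d \<otimes>\<^bsub>Q\<^esub> y)" using c by algebra
    also have "\<dots> = h (r \<otimes> k)" using y r by simp
    finally show ?thesis using smult[OF r y(2)] y r by blast
  qed
  show "subgroup ?K (add_monoid R)"
  proof (rule R.add.subgroupI)
    have "h d \<otimes>\<^bsub>Q\<^esub> \<zero>\<^bsub>Q\<^esub> = h \<zero>" using d' by simp
    then have "\<zero> \<in> ?K" using J'.one_closed by auto
    then show "?K \<noteq> {}" by blast
    fix k assume k: "k \<in> ?K"
    show "\<ominus> k \<in> ?K" using mult[OF k, of "\<ominus> \<one>"] k by (simp add: R.l_minus)
    fix l assume l: "l \<in> ?K"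
    from k obtain y where y: "k \<in> carrier R" "y \<in> J'" "h d \<otimes>\<^bsub>Q\<^esub> y = h k" by blast
    from l obtain z where z: "l \<in> carrier R" "z \<in> J'" "h d \<otimes>\<^bsub>Q\<^esub> z = h l" by blast
    have "h d \<otimes>\<^bsub>Q\<^esub> (y \<oplus>\<^bsub>Q\<^esub> z) = h (k \<oplus> l)"
      using y z d' J'c by (simp add: Q.r_distr)
    moreover have "y \<oplus>\<^bsub>Q\<^esub> z \<in> J'" using J'.m_closed[OF y(2) z(2)] by simp
    ultimately show "k \<oplus> l \<in> ?K" using y z by blast
  qed auto
  show "r \<otimes> k \<in> ?K" if "k \<in> ?K" "r \<in> carrier R" for k r
    using mult[OF that] .
  then show "k \<otimes> r \<in> ?K" if "k \<in> ?K" "r \<in> carrier R" for k r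
    using that by (metis (no_types, lifting) R.m_comm mem_Collect_eq)
qed (rule R.ring_axioms)

text \<open>The equation \<open>J J' = R\<close> writes \<open>1\<close> as a finite sum of products
  \<open>j y\<close>. Let \<open>d\<close> be a common denominator of the elements \<open>y\<close>
  and \<open>K\<close> the preimage of \<open>d J'\<close>. Then \<open>d\<close> lies in
  \<open>J K\<close>, while \<open>J K \<subseteq> d R\<close> because
  \<open>J J' \<subseteq> R\<close>.\<close>

lemma principal_prod_if_invertible:
  assumes J: "ideal J R"
    and J': "subgroup J' (add_monoid Q)"
    and smult: "\<And>r x. r \<in> carrier R \<Longrightarrow> x \<in> J' \<Longrightarrow> h r \<otimes>\<^bsub>Q\<^esub> x \<in> J'"
    and JJ': "ideal_prod Q (h ` J) J' = h ` carrier R"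
  shows "\<exists>K d. ideal K R \<and> d \<in> S \<and> ideal_prod R J K = PIdl d"
proof -
  interpret J': subgroup J' "add_monoid Q" by fact
  have J'c: "y \<in> carrier Q" if "y \<in> J'" for y using J'.subset that by auto
  have Jc: "j \<in> carrier R" if "j \<in> J" for j using ideal.Icarr[OF J that] .
  \<comment> \<open>The denominator stays a parameter, as it is fixed only once \<open>1\<close> has
    been put over a common denominator.\<close>
  define K where "K d = {k \<in> carrier R. \<exists>y\<in>J'. h d \<otimes>\<^bsub>Q\<^esub> y = h k}" for d
  have K: "ideal (K d) R" if "d \<in> S" for d
    unfolding K_def using ideal_denominators[OF J' smult that] .
  \<comment> \<open>Passing from the denominator \<open>d\<close> to \<open>e \<otimes> d\<close>
    multiplies numerators by \<open>e\<close>; this allows two sums over different denominators to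
    be added.\<close>
  have scale: "e \<otimes> c \<in> ideal_prod R J (K (e \<otimes> d))"
    if "c \<in> ideal_prod R J (K d)" "d \<in> S" "e \<in> carrier R" for c d e
    using that(1)
  proof induction
    case (prod j k)
    then obtain y where y: "k \<in> carrier R" "y \<in> J'" "h d \<otimes>\<^bsub>Q\<^esub> y = h k"
      unfolding K_def by blast
    have "h (e \<otimes> d) \<otimes>\<^bsub>Q\<^esub> y = h (e \<otimes> k)"
      using y that(2,3) S_carrier J'c by (simp add: Q.m_assoc)
    then have "e \<otimes> k \<in> K (e \<otimes> d)" using y that(3) unfolding K_def by blast
    then have "j \<otimes> (e \<otimes> k) \<in> ideal_prod R J (K (e \<otimes> d))" using prod(1) by (intro ideal_prod.prod)
    also have "j \<otimes> (e \<otimes> k) = e \<otimes> (j \<otimes> k)" using Jc[OF prod(1)] y(1) that(3) by algebra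
    finally show ?case .
  next
    case (sum c1 c2)
    have "c1 \<in> carrier R" "c2 \<in> carrier R"
      using sum R.ideal_prod_in_carrier[OF J K[OF that(2)]] by auto
    with sum that(3) show ?case by (simp add: R.r_distr ideal_prod.sum)
  qed
  \<comment> \<open>A sum over \<open>d1\<close> and a sum over \<open>d2\<close> are merged over
    \<open>d1 \<otimes> d2\<close>. Membership in \<open>carrier Q\<close> is carried along for the
    use of \<open>h_add_fractions\<close>.\<close>
  have common_denominator:
    "x \<in> carrier Q \<and> (\<exists>d\<in>S. \<exists>c\<in>ideal_prod R J (K d). h d \<otimes>\<^bsub>Q\<^esub> x = h c)"
    if "x \<in> ideal_prod Q (h ` J) J'" for x
    using that
  proof induction
    case (prod i y)
    then obtain j where j: "j \<in> J" "i = h j" by auto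
    have y: "y \<in> carrier Q" using prod J'c by auto
    then obtain d k where d: "d \<in> S" "k \<in> carrier R" "h d \<otimes>\<^bsub>Q\<^esub> y = h k" by (rule denominatorE)
    note c = y hom.hom_closed[OF Jc[OF j(1)]] hom.hom_closed[OF S_carrier[OF d(1)]]
    have "h d \<otimes>\<^bsub>Q\<^esub> (h j \<otimes>\<^bsub>Q\<^esub> y) = h j \<otimes>\<^bsub>Q\<^esub> (h d \<otimes>\<^bsub>Q\<^esub> y)" using c by algebra
    also have "\<dots> = h (j \<otimes> k)" using d Jc j by simp
    finally have "h d \<otimes>\<^bsub>Q\<^esub> (h j \<otimes>\<^bsub>Q\<^esub> y) = h (j \<otimes> k)" .
    moreover have "k \<in> K d" using d prod(2) unfolding K_def by blast
    then have "j \<otimes> k \<in> ideal_prod R J (K d)" using j(1) by (intro ideal_prod.prod)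
    ultimately show ?case using d(1) c j(2) by auto
  next
    case (sum x1 x2)
    then obtain d1 c1 d2 c2 where x: "x1 \<in> carrier Q" "x2 \<in> carrier Q" and d: "d1 \<in> S" "d2 \<in> S"
      and c: "c1 \<in> ideal_prod R J (K d1)" "c2 \<in> ideal_prod R J (K d2)"
      and eq: "h d1 \<otimes>\<^bsub>Q\<^esub> x1 = h c1" "h d2 \<otimes>\<^bsub>Q\<^esub> x2 = h c2"
      by blast
    have cR: "c1 \<in> carrier R" "c2 \<in> carrier R"
      using c R.ideal_prod_in_carrier[OF J K] d by auto
    have "d2 \<otimes> c1 \<in> ideal_prod R J (K (d1 \<otimes> d2))"
      using scale[OF c(1) d(1) S_carrier[OF d(2)]] d S_carrier by (simp add: R.m_comm)
    moreover have "d1 \<otimes> c2 \<in> ideal_prod R J (K (d1 \<otimes> d2))"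
      using scale[OF c(2) d(2) S_carrier[OF d(1)]] .
    ultimately have "d2 \<otimes> c1 \<oplus> d1 \<otimes> c2 \<in> ideal_prod R J (K (d1 \<otimes> d2))"
      by (rule ideal_prod.sum)
    with h_add_fractions[OF x d cR eq] show ?case using d x by blast
  qed
  \<comment> \<open>For the element \<open>1\<close> the numerator \<open>c\<close> is
    \<open>d\<close> itself, so \<open>d\<close> lies in the product of \<open>J\<close> and
    \<open>K d\<close>.\<close>
  have "\<one>\<^bsub>Q\<^esub> \<in> ideal_prod Q (h ` J) J'" unfolding JJ' using hom.hom_one[symmetric] by blast
  then obtain d c where d: "d \<in> S" "c \<in> ideal_prod R J (K d)" "h d \<otimes>\<^bsub>Q\<^esub> \<one>\<^bsub>Q\<^esub> = h c"
    using common_denominator by blast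
  have "c \<in> carrier R" using d R.ideal_prod_in_carrier[OF J K] by auto
  then have "d = c" using d S_carrier h_eq_iff by auto
  then have "PIdl d \<subseteq> ideal_prod R J (K d)"
    using d J K by (intro R.cgenideal_minimal R.ideal_prod_is_ideal) auto
  moreover have "x \<in> PIdl d" if "x \<in> ideal_prod R J (K d)" for x
    using that
  proof induction
    case (prod j k)
    then obtain y where y: "k \<in> carrier R" "y \<in> J'" "h d \<otimes>\<^bsub>Q\<^esub> y = h k"
      unfolding K_def by blast
    \<comment> \<open>Here \<open>J J' \<subseteq> R\<close> enters: \<open>h j y = h r\<close> for
      some \<open>r\<close> in \<open>R\<close>, and multiplying by \<open>h d\<close> gives
      \<open>j k = r d\<close>.\<close>
    have "h j \<otimes>\<^bsub>Q\<^esub> y \<in> h ` carrier R"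
      unfolding JJ'[symmetric] using prod y by (intro ideal_prod.prod) auto
    then obtain r where r: "r \<in> carrier R" "h j \<otimes>\<^bsub>Q\<^esub> y = h r" by auto
    note c = J'c[OF y(2)] hom.hom_closed[OF Jc[OF prod(1)]] hom.hom_closed[OF S_carrier[OF d(1)]]
    have "h (j \<otimes> k) = h j \<otimes>\<^bsub>Q\<^esub> (h d \<otimes>\<^bsub>Q\<^esub> y)" using y Jc[OF prod(1)] by simp
    also have "\<dots> = (h j \<otimes>\<^bsub>Q\<^esub> y) \<otimes>\<^bsub>Q\<^esub> h d" using c by algebra
    also have "\<dots> = h (r \<otimes> d)" using r d S_carrier by simp
    finally have "j \<otimes> k = r \<otimes> d"
      using h_eq_iff R.m_closed[OF Jc[OF prod(1)] y(1)] R.m_closed[OF r(1) S_carrier[OF d(1)]] by blast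
    with r(1) show ?case by (auto simp: cgenideal_def)
  next
    case (sum x1 x2)
    then show ?case using R.cgenideal_ideal[OF S_carrier[OF d(1)]]
      by (simp add: additive_subgroup.a_closed ideal_def)
  qed
  ultimately have "ideal_prod R J (K d) = PIdl d" by blast
  with K d(1) show ?thesis by blast
qed

text \<open>The submodule \<open>J' = K / h d\<close> works: \<open>J J'\<close> is
  \<open>(J K) / h d\<close>, which is \<open>R\<close> because \<open>J K = d R\<close>.\<close>

lemma invertible_if_principal_prod:
  assumes J: "ideal J R" and K: "ideal K R" and d: "d \<in> S" and JK: "ideal_prod R J K = PIdl d"
  obtains J' where "subgroup J' (add_monoid Q)"
    "\<And>r x. r \<in> carrier R \<Longrightarrow> x \<in> J' \<Longrightarrow> h r \<otimes>\<^bsub>Q\<^esub> x \<in> J'"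
    "ideal_prod Q (h ` J) J' = h ` carrier R"
proof
  define J' where "J' = {x \<in> carrier Q. \<exists>k\<in>K. h d \<otimes>\<^bsub>Q\<^esub> x = h k}"
  interpret K: ideal K R by fact
  have dR: "d \<in> carrier R" and dQ: "h d \<in> carrier Q" using d S_carrier by auto
  have Jc: "j \<in> carrier R" if "j \<in> J" for j using ideal.Icarr[OF J that] .
  show smult: "h r \<otimes>\<^bsub>Q\<^esub> x \<in> J'" if "r \<in> carrier R" "x \<in> J'" for r x
  proof -
    from that(2) obtain k where x: "x \<in> carrier Q" and k: "k \<in> K" "h d \<otimes>\<^bsub>Q\<^esub> x = h k"
      unfolding J'_def by blast
    note c = x dQ hom.hom_closed[OF that(1)]
    have "h d \<otimes>\<^bsub>Q\<^esub> (h r \<otimes>\<^bsub>Q\<^esub> x) = h r \<otimes>\<^bsub>Q\<^esub> (h d \<otimes>\<^bsub>Q\<^esub> x)" using c by algebra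
    also have "\<dots> = h (r \<otimes> k)" using k that by simp
    finally show ?thesis using c k that K.I_l_closed unfolding J'_def by blast
  qed
  show "subgroup J' (add_monoid Q)"
  proof (rule Q.add.subgroupI)
    have "h d \<otimes>\<^bsub>Q\<^esub> \<zero>\<^bsub>Q\<^esub> = h \<zero>" using dQ by simp
    then have "\<zero>\<^bsub>Q\<^esub> \<in> J'" using K.zero_closed unfolding J'_def by blast
    then show "J' \<noteq> {}" by blast
    fix x assume x: "x \<in> J'"
    then have "x \<in> carrier Q" unfolding J'_def by blast
    then show "\<ominus>\<^bsub>Q\<^esub> x \<in> J'" using smult[of "\<ominus> \<one>" x] x by (simp add: Q.l_minus)
    fix y assume y: "y \<in> J'"
    from x y obtain k l where "x \<in> carrier Q" "y \<in> carrier Q" and k: "k \<in> K" "l \<in> K"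
      "h d \<otimes>\<^bsub>Q\<^esub> x = h k" "h d \<otimes>\<^bsub>Q\<^esub> y = h l"
      unfolding J'_def by blast
    then have "x \<oplus>\<^bsub>Q\<^esub> y \<in> carrier Q" "h d \<otimes>\<^bsub>Q\<^esub> (x \<oplus>\<^bsub>Q\<^esub> y) = h (k \<oplus> l)"
      using dQ by (simp_all add: Q.r_distr)
    then show "x \<oplus>\<^bsub>Q\<^esub> y \<in> J'" using K.a_closed[OF k(1,2)] unfolding J'_def by blast
  qed (auto simp: J'_def)
  show "ideal_prod Q (h ` J) J' = h ` carrier R"
  proof (intro equalityI subsetI)
    fix x assume "x \<in> ideal_prod Q (h ` J) J'"
    then show "x \<in> h ` carrier R"
    proof induction
      case (prod i x)
      then obtain j k where j: "j \<in> J" "i = h j" and x: "x \<in> carrier Q" and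
        k: "k \<in> K" "h d \<otimes>\<^bsub>Q\<^esub> x = h k" unfolding J'_def by blast
      have "j \<otimes> k \<in> PIdl d" unfolding JK[symmetric] using j k by (intro ideal_prod.prod)
      then obtain r where r: "r \<in> carrier R" "j \<otimes> k = r \<otimes> d" by (auto simp: cgenideal_def)
      note c = x dQ hom.hom_closed[OF Jc[OF j(1)]]
      have "h d \<otimes>\<^bsub>Q\<^esub> (h j \<otimes>\<^bsub>Q\<^esub> x) = h j \<otimes>\<^bsub>Q\<^esub> (h d \<otimes>\<^bsub>Q\<^esub> x)" using c by algebra
      also have "\<dots> = h (j \<otimes> k)" using Jc[OF j(1)] k by simp
      also have "\<dots> = h d \<otimes>\<^bsub>Q\<^esub> h r" unfolding r(2) using r(1) dR dQ by (simp add: Q.m_comm)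
      finally have "h j \<otimes>\<^bsub>Q\<^esub> x = h r" using h_cancel[OF d] c r(1) by simp
      then show ?case using j r by auto
    next
      case (sum s1 s2)
      then obtain a b where "a \<in> carrier R" "b \<in> carrier R" "s1 = h a" "s2 = h b" by auto
      then show ?case by (auto intro!: image_eqI[of _ h "a \<oplus> b"])
    qed
  next
    \<comment> \<open>Dividing by \<open>h d\<close> is done for every \<open>c\<close> in
      \<open>J K\<close>, so that the induction over sums goes through; it is then applied to
      \<open>c = r \<otimes> d\<close>, whose quotient is \<open>h r\<close>.\<close>
    have fractions: "\<exists>x\<in>ideal_prod Q (h ` J) J'. x \<in> carrier Q \<and> h d \<otimes>\<^bsub>Q\<^esub> x = h c"
      if "c \<in> ideal_prod R J K" for c
      using that
    proof induction
      case (prod j k)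
      then have jc: "h j \<in> carrier Q" and k: "k \<in> carrier R" using Jc by auto
      obtain y where y: "y \<in> carrier Q" "h d \<otimes>\<^bsub>Q\<^esub> y = h k" using divide[OF d, of "h k"] k by auto
      have "h d \<otimes>\<^bsub>Q\<^esub> (h j \<otimes>\<^bsub>Q\<^esub> y) = h j \<otimes>\<^bsub>Q\<^esub> (h d \<otimes>\<^bsub>Q\<^esub> y)" using jc y(1) dQ by algebra
      also have "\<dots> = h (j \<otimes> k)" using Jc[OF prod(1)] k y by simp
      finally have "h d \<otimes>\<^bsub>Q\<^esub> (h j \<otimes>\<^bsub>Q\<^esub> y) = h (j \<otimes> k)" .
      moreover have "y \<in> J'" using y prod(2) unfolding J'_def by blast
      then have "h j \<otimes>\<^bsub>Q\<^esub> y \<in> ideal_prod Q (h ` J) J'" using prod(1) by (auto intro: ideal_prod.prod)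
      ultimately show ?case using jc y(1) by blast
    next
      case (sum c1 c2)
      then obtain x1 x2 where x: "x1 \<in> ideal_prod Q (h ` J) J'" "x2 \<in> ideal_prod Q (h ` J) J'"
        and xc: "x1 \<in> carrier Q" "x2 \<in> carrier Q"
        and eq: "h d \<otimes>\<^bsub>Q\<^esub> x1 = h c1" "h d \<otimes>\<^bsub>Q\<^esub> x2 = h c2" by blast
      have "c1 \<in> carrier R" "c2 \<in> carrier R" using sum R.ideal_prod_in_carrier[OF J K] by auto
      then have "h d \<otimes>\<^bsub>Q\<^esub> (x1 \<oplus>\<^bsub>Q\<^esub> x2) = h (c1 \<oplus> c2)" using xc eq dQ by (simp add: Q.r_distr)
      with x xc show ?case by (blast intro: ideal_prod.sum Q.a_closed)
    qed
    fix x assume "x \<in> h ` carrier R"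
    then obtain r where r: "r \<in> carrier R" "x = h r" by auto
    have "r \<otimes> d \<in> ideal_prod R J K" unfolding JK using r by (auto simp: cgenideal_def)
    then obtain y where y: "y \<in> ideal_prod Q (h ` J) J'" "y \<in> carrier Q" "h d \<otimes>\<^bsub>Q\<^esub> y = h (r \<otimes> d)"
      using fractions by blast
    have "h (r \<otimes> d) = h d \<otimes>\<^bsub>Q\<^esub> x" using r dR dQ by (simp add: Q.m_comm)
    then have "y = x" using y r h_cancel[OF d, of y x] by simp
    then show "x \<in> ideal_prod Q (h ` J) J'" using y by simp
  qed
qed

end

section \<open>Fraction rings as localizations, and invertibility without the total quotient
  ring\<close>

lemma (in regular_submonoid) localization_fraction_ring:
  "localization R (fraction_ring R S) S (\<lambda>a. frac a \<one>)"
proof -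
  interpret Q: cring "fraction_ring R S" by (rule cring_fraction_ring)
  show ?thesis
  proof
    show "(\<lambda>a. frac a \<one>) \<in> ring_hom R (fraction_ring R S)"
      by (rule ring_hom_memI) (simp_all add: frac_simps frac_closed)
    show "inj_on (\<lambda>a. frac a \<one>) (carrier R)"
      by (rule inj_onI) (simp add: frac_eq_iff)
    show "frac s \<one> \<in> Units (fraction_ring R S)" if "s \<in> S" for s
    proof -
      have "frac \<one> s \<otimes>\<^bsub>fraction_ring R S\<^esub> frac s \<one> = \<one>\<^bsub>fraction_ring R S\<^esub>"
        "frac s \<one> \<otimes>\<^bsub>fraction_ring R S\<^esub> frac \<one> s = \<one>\<^bsub>fraction_ring R S\<^esub>"
        using that by (simp_all add: frac_simps carrierI)
      with that show ?thesis
        unfolding Units_def using frac_closed[of \<one> s] frac_closed[of s \<one>] carrierI by auto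
    qed
    show "\<exists>s\<in>S. \<exists>a\<in>carrier R. frac s \<one> \<otimes>\<^bsub>fraction_ring R S\<^esub> x = frac a \<one>"
      if "x \<in> carrier (fraction_ring R S)" for x
    proof -
      from that obtain a s where "a \<in> carrier R" "s \<in> S" "x = frac a s" by (rule frac_cases)
      then show ?thesis
        by (intro bexI[of _ s] bexI[of _ a]) (simp_all add: frac_simps carrierI)
    qed
  qed
qed

lemma (in cring) regular_submonoid_regular_elements: "regular_submonoid R (regular_elements R)"
  using submonoid_regular_elements cring_axioms
  by (auto simp: regular_submonoid_def regular_submonoid_axioms_def)

lemma (in cring) localization_total_quotient_ring:
  "localization R (total_quotient_ring R) (regular_elements R) (to_total_quotient R)"
  using regular_submonoid.localization_fraction_ring[OF regular_submonoid_regular_elements]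
  unfolding total_quotient_ring_def to_total_quotient_def .

text \<open>Both sides of \<open>r (a/s) = (r/1) (a/s)\<close> have numerator
  \<open>r \<otimes> a\<close> and the same denominator. The module structure in
  \<open>invertible_ideal\<close> can thus be read as multiplication by images of
  \<open>R\<close>.\<close>

lemma (in cring) smult_total_quotient_ring:
  assumes "r \<in> carrier R" "x \<in> carrier (total_quotient_ring R)"
  shows "r \<odot>\<^bsub>total_quotient_ring R\<^esub> x = to_total_quotient R r \<otimes>\<^bsub>total_quotient_ring R\<^esub> x"
proof -
  interpret T: regular_submonoid R "regular_elements R" by (rule regular_submonoid_regular_elements)
  from assms(2) obtain a s where "a \<in> carrier R" "s \<in> regular_elements R" "x = T.frac a s"
    unfolding total_quotient_ring_def by (rule T.frac_cases)
  then show ?thesis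
    using assms(1) unfolding total_quotient_ring_def to_total_quotient_def
    by (simp add: T.frac_smult T.frac_mult T.carrierI)
qed

text \<open>The instance of the two preceding constructions for the total quotient ring. The
  right-hand side lives in \<open>R\<close> alone and therefore passes to extensions.\<close>

lemma (in cring) invertible_ideal_iff:
  "invertible_ideal R J \<longleftrightarrow> ideal J R \<and>
    (\<exists>K d. ideal K R \<and> d \<in> regular_elements R \<and> J \<cdot> K = PIdl d)"
proof -
  interpret T: localization R "total_quotient_ring R" "regular_elements R" "to_total_quotient R"
    by (rule localization_total_quotient_ring)
  \<comment> \<open>Translates submodules into the form used in \<open>localization\<close>:
    additive subgroups closed under multiplication by the image of \<open>R\<close>.\<close>
  have submodule_iff: "submodule J' R (total_quotient_ring R) \<longleftrightarrow>
      subgroup J' (add_monoid (total_quotient_ring R)) \<and>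
      (\<forall>r\<in>carrier R. \<forall>x\<in>J'. to_total_quotient R r \<otimes>\<^bsub>total_quotient_ring R\<^esub> x \<in> J')" for J'
  proof (cases "subgroup J' (add_monoid (total_quotient_ring R))")
    case True
    then have "x \<in> carrier (total_quotient_ring R)" if "x \<in> J'" for x
      using subgroup.subset[OF True] that by auto
    with True show ?thesis
      by (simp add: submodule_def submodule_axioms_def smult_total_quotient_ring Ball_def)
  qed (simp add: submodule_def)
  show ?thesis
  proof
    assume "invertible_ideal R J"
    then obtain J' where J: "ideal J R" and J': "submodule J' R (total_quotient_ring R)"
      "ideal_prod (total_quotient_ring R) (to_total_quotient R ` J) J'
        = to_total_quotient R ` carrier R"
      unfolding invertible_ideal_def by auto
    have "\<exists>K d. ideal K R \<and> d \<in> regular_elements R \<and> J \<cdot> K = PIdl d"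
      using J' by (intro T.principal_prod_if_invertible[OF J, of J']) (auto simp: submodule_iff)
    with J show "ideal J R \<and> (\<exists>K d. ideal K R \<and> d \<in> regular_elements R \<and> J \<cdot> K = PIdl d)"
      by simp
  next
    assume "ideal J R \<and> (\<exists>K d. ideal K R \<and> d \<in> regular_elements R \<and> J \<cdot> K = PIdl d)"
    then obtain K d where J: "ideal J R" and K: "ideal K R" "d \<in> regular_elements R"
      "J \<cdot> K = PIdl d" by auto
    obtain J' where "submodule J' R (total_quotient_ring R)"
      "ideal_prod (total_quotient_ring R) (to_total_quotient R ` J) J'
        = to_total_quotient R ` carrier R"
      using T.invertible_if_principal_prod[OF J K] unfolding submodule_iff by metis
    with J show "invertible_ideal R J" unfolding invertible_ideal_def by auto
  qed
qed

context localization
begin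

text \<open>Extending \<open>J K = d R\<close> to \<open>Q\<close> gives a principal product again,
  and \<open>h d\<close> is still regular.\<close>

lemma invertible_ext:
  assumes "invertible_ideal R J"
  shows "invertible_ideal Q (ext J)"
proof -
  from assms obtain K d where J: "ideal J R" and K: "ideal K R" "d \<in> regular_elements R"
    "ideal_prod R J K = PIdl d"
    unfolding R.invertible_ideal_iff by blast
  then have "ideal_prod Q (ext J) (ext K) = PIdl\<^bsub>Q\<^esub> (h d)"
    using ext_PIdl regular_elementsD(1) by (metis ext_ideal_prod)
  then show ?thesis
    unfolding Q.invertible_ideal_iff using J K ideal_ext regular_h by blast
qed

section \<open>ISP-rings\<close>

text \<open>The factors \<open>H\<^sub>i\<close> of the contraction \<open>I\<^sub>0\<close> of \<open>I\<close> that meet \<open>S\<close> become trivial in \<open>Q\<close>. Not all of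
  them do: otherwise \<open>I\<close> is the extension of \<open>J\<close>, so \<open>J \<subseteq> I\<^sub>0 \<subseteq> J H\<^sub>1\<close>, and cancelling \<open>J\<close> gives
  \<open>1 \<in> H\<^sub>1\<close>.\<close>

theorem ISP_ring_localization:
  assumes "ISP_ring R"
  shows "ISP_ring Q"
  unfolding ISP_ring_def
proof (intro conjI allI impI)
  show "cring Q" by (rule Q.cring_axioms)
  have "\<one> \<noteq> \<zero>" using assms by (simp add: ISP_ring_def)
  then show "\<one>\<^bsub>Q\<^esub> \<noteq> \<zero>\<^bsub>Q\<^esub>" using h_eq_iff[of \<one> \<zero>] by simp
  fix I assume "regular_ideal Q I \<and> I \<noteq> carrier Q"
  then obtain x where I: "ideal I Q" and proper: "I \<noteq> carrier Q"
    and x: "x \<in> I" "x \<in> regular_elements Q"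
    by (auto simp: regular_ideal_def)
  let ?I = "contraction I"
  have I': "ideal ?I R" using I by (rule ideal_contraction)
  \<comment> \<open>The numerator \<open>a\<close> of the regular element \<open>x\<close> will be a
    regular element of the contraction.\<close>
  obtain s a where s: "s \<in> S" "a \<in> carrier R" "h s \<otimes>\<^bsub>Q\<^esub> x = h a"
    using denominatorE[of x] regular_elementsD(1)[OF x(2)] by blast
  have "h a \<in> I" using ideal.I_l_closed[OF I x(1), of "h s"] s S_carrier by auto
  then have "regular_ideal R ?I"
    using regular_numerator[OF x(2) s] I' s(2) by (auto simp: regular_ideal_def contraction_def)
  moreover have "?I \<noteq> carrier R"
  proof
    assume "?I = carrier R"
    then have "\<one> \<in> ?I" by simp
    then have "\<one>\<^bsub>Q\<^esub> \<in> I" by (simp add: contraction_def)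
    then show False using ideal.one_imp_carrier[OF I] proper by simp
  qed
  ultimately obtain J Hs where J: "invertible_ideal R J" and Hs: "Hs \<noteq> []"
    "\<forall>H\<in>set Hs. proper_radical_ideal R H" and eq: "?I = foldl (ideal_prod R) J Hs"
    using assms unfolding ISP_ring_def by blast
  from J obtain K d where JR: "ideal J R" and K: "ideal K R" "d \<in> regular_elements R"
    "ideal_prod R J K = PIdl d"
    unfolding R.invertible_ideal_iff by blast
  have HsR: "\<forall>H\<in>set Hs. ideal H R" using Hs(2) by (auto simp: proper_radical_ideal_def)
  let ?Hs = "filter (\<lambda>H. H \<noteq> carrier Q) (map ext Hs)"
  have "I = foldl (ideal_prod Q) (ext J) (map ext Hs)"
    using ext_contraction[OF I] ext_foldl_ideal_prod[OF JR HsR] eq by simp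
  also have "\<dots> = foldl (ideal_prod Q) (ext J) ?Hs"
    using JR HsR ideal_ext by (intro Q.foldl_ideal_prod_filter_proper[symmetric]) auto
  finally have I_eq: "I = foldl (ideal_prod Q) (ext J) ?Hs" .
  have "?Hs \<noteq> []"
  proof
    assume "?Hs = []"
    then have "I = ext J" using I_eq by simp
    then have "J \<subseteq> ?I" using h_in_ext[OF JR] ideal.Icarr[OF JR] by (auto simp: contraction_def)
    moreover obtain H Hs' where H: "Hs = H # Hs'" using Hs(1) by (cases Hs) auto
    have HR: "ideal H R" "\<forall>H\<in>set Hs'. ideal H R" using HsR H by auto
    have "?I \<subseteq> ideal_prod R J H"
      using R.foldl_ideal_prod_subset[OF R.ideal_prod_is_ideal[OF JR HR(1)] HR(2)]
      by (simp add: eq H)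
    ultimately have "H = carrier R"
      by (intro R.invertible_ideal_cancel[OF JR K(1) HR(1) K(2,3)]) (rule order_trans)
    then show False using Hs(2) H by (simp add: proper_radical_ideal_def)
  qed
  moreover have "\<forall>H\<in>set ?Hs. proper_radical_ideal Q H"
    using Hs(2) proper_radical_ext by auto
  ultimately show "\<exists>J Hs. invertible_ideal Q J \<and> Hs \<noteq> [] \<and>
      (\<forall>H\<in>set Hs. proper_radical_ideal Q H) \<and> I = foldl (ideal_prod Q) J Hs"
    using invertible_ext[OF J] I_eq by blast
qed

end

section \<open>Regular localizations as subrings of the total quotient ring\<close>

lemma (in cring) localization_regular_localization:
  assumes "primeideal P R"
  shows "localization R (regular_localization R P) (regular_elements R - P) (to_total_quotient R)"
proof -
  interpret P: primeideal P R by fact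
  interpret T: regular_submonoid R "regular_elements R" by (rule regular_submonoid_regular_elements)
  let ?T = "total_quotient_ring R"
  let ?S = "regular_elements R - P"
  let ?C = "{T.frac a b | a b. a \<in> carrier R \<and> b \<in> ?S}"
  interpret T': cring ?T
    using T.cring_fraction_ring by (simp add: total_quotient_ring_def)
  \<comment> \<open>Elements are still classes of the total quotient ring, whose representatives may
    have any regular denominator. So this is not literally \<open>fraction_ring R ?S\<close>, and
    the \<open>localization\<close> axioms are checked directly.\<close>
  have Q: "regular_localization R P = ?T\<lparr>carrier := ?C\<rparr>"
    unfolding regular_localization_def by (rule arg_cong[of _ _ "\<lambda>C. ?T\<lparr>carrier := C\<rparr>"])
      (auto dest: T.carrierI)
  \<comment> \<open>Primality of \<open>P\<close> makes its complement closed under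
    products.\<close>
  have S: "submonoid ?S R"
  proof
    show "\<one> \<in> ?S" using P.one_imp_carrier P.I_notcarr by auto
    show "x \<otimes> y \<in> ?S" if "x \<in> ?S" "y \<in> ?S" for x y
      using that P.I_prime[of x y] T.carrierI by auto
  qed (auto dest: T.carrierI)
  note T_simps = T.frac_simps[folded total_quotient_ring_def]
  \<comment> \<open>The ring axioms are inherited from \<open>?T\<close> once \<open>?C\<close> is
    closed under the operations.\<close>
  have "subring ?C ?T"
  proof (rule T'.subringI)
    show "?C \<subseteq> carrier ?T"
      using T.frac_closed by (auto simp: total_quotient_ring_def)
    show "\<one>\<^bsub>?T\<^esub> \<in> ?C" using submonoid.one_closed[OF S] T_simps(4) by blast
    fix x assume "x \<in> ?C"
    then obtain a s where x: "x = T.frac a s" "a \<in> carrier R" "s \<in> ?S" by blast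
    note s = T.carrierI[of s]
    have "T.frac (\<ominus> a) s \<oplus>\<^bsub>?T\<^esub> x = \<zero>\<^bsub>?T\<^esub>"
      using x s by (simp add: T_simps l_neg r_minus)
    then have "\<ominus>\<^bsub>?T\<^esub> x = T.frac (\<ominus> a) s"
      using x by (intro T'.minus_equality) (simp_all add: T.frac_closed[folded total_quotient_ring_def])
    then show "\<ominus>\<^bsub>?T\<^esub> x \<in> ?C" using x by blast
    fix y assume "y \<in> ?C"
    then obtain b t where y: "y = T.frac b t" "b \<in> carrier R" "t \<in> ?S" by blast
    have st: "s \<otimes> t \<in> ?S" using x y submonoid.m_closed[OF S] by blast
    have "x \<otimes>\<^bsub>?T\<^esub> y = T.frac (a \<otimes> b) (s \<otimes> t)" using x y by (simp add: T_simps)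
    with x y st show "x \<otimes>\<^bsub>?T\<^esub> y \<in> ?C" by blast
    have "x \<oplus>\<^bsub>?T\<^esub> y = T.frac (t \<otimes> a \<oplus> s \<otimes> b) (s \<otimes> t)" using x y by (simp add: T_simps)
    moreover have "t \<otimes> a \<oplus> s \<otimes> b \<in> carrier R" using x y T.carrierI by simp
    ultimately show "x \<oplus>\<^bsub>?T\<^esub> y \<in> ?C" using st by blast
  qed
  then interpret Q: cring "?T\<lparr>carrier := ?C\<rparr>"
    using T'.subcringI' T'.subcring_iff subringE(1) by blast
  interpret S: submonoid ?S R by (rule S)
  have closed: "T.frac a s \<in> ?C" if "a \<in> carrier R" "s \<in> ?S" for a s using that by blast
  show ?thesis
    unfolding Q to_total_quotient_def
  proof
    show "(\<lambda>a. T.frac a \<one>) \<in> ring_hom R (?T\<lparr>carrier := ?C\<rparr>)"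
      by (rule ring_hom_memI) (use closed S.one_closed in \<open>auto simp: T_simps\<close>)
    show "inj_on (\<lambda>a. T.frac a \<one>) (carrier R)"
      by (rule inj_onI) (simp add: T_simps)
    show "T.frac s \<one> \<in> Units (?T\<lparr>carrier := ?C\<rparr>)" if "s \<in> ?S" for s
    proof -
      have "T.frac \<one> s \<otimes>\<^bsub>?T\<lparr>carrier := ?C\<rparr>\<^esub> T.frac s \<one> = \<one>\<^bsub>?T\<lparr>carrier := ?C\<rparr>\<^esub>"
        "T.frac s \<one> \<otimes>\<^bsub>?T\<lparr>carrier := ?C\<rparr>\<^esub> T.frac \<one> s = \<one>\<^bsub>?T\<lparr>carrier := ?C\<rparr>\<^esub>"
        using that by (simp_all add: T_simps T.carrierI)
      \<comment> \<open>The inverse must lie in the smaller carrier, which holds as \<open>s\<close>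
        is outside \<open>P\<close>.\<close>
      moreover have "T.frac \<one> s \<in> ?C" "T.frac s \<one> \<in> ?C"
        using that closed S.one_closed T.carrierI by blast+
      ultimately show ?thesis unfolding Units_def by auto
    qed
    show "\<exists>s\<in>?S. \<exists>a\<in>carrier R. T.frac s \<one> \<otimes>\<^bsub>?T\<lparr>carrier := ?C\<rparr>\<^esub> x = T.frac a \<one>"
      if "x \<in> carrier (?T\<lparr>carrier := ?C\<rparr>)" for x
    proof -
      from that obtain a s where "a \<in> carrier R" "s \<in> ?S" "x = T.frac a s" by auto
      then show ?thesis
        by (intro bexI[of _ s] bexI[of _ a]) (simp_all add: T_simps T.carrierI)
    qed
  qed
qed

text \<open>Both kinds of rings are models of \<open>localization\<close>, so each claim is an
  instance of \<open>ISP_ring_localization\<close>.\<close>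

theorem proposition2p5:
  fixes A :: "('a, 'm) ring_scheme"
  assumes "ISP_ring A"
  shows "(\<forall>S. submonoid S A \<and> S \<subseteq> regular_elements A \<longrightarrow> ISP_ring (fraction_ring A S)) \<and>
    (\<forall>P. primeideal P A \<longrightarrow> ISP_ring (regular_localization A P))"
proof (intro conjI allI impI)
  interpret cring A using assms by (simp add: ISP_ring_def)
  fix S assume "submonoid S A \<and> S \<subseteq> regular_elements A"
  then have "regular_submonoid A S"
    using cring_axioms by (simp add: regular_submonoid_def regular_submonoid_axioms_def)
  from regular_submonoid.localization_fraction_ring[OF this]
  show "ISP_ring (fraction_ring A S)"
    using localization.ISP_ring_localization assms by blast
next
  interpret cring A using assms by (simp add: ISP_ring_def)
  fix P assume "primeideal P A"
  from localization_regular_localization[OF this]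
  show "ISP_ring (regular_localization A P)"
    using localization.ISP_ring_localization assms by blast
qed

end
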